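(* Let $n\ge 7$. Every elongated triangular prism graph $G$ with exactly $2n-3$ vertices satisfies that $K_n$ is a minor of $\overline{G}$.
   Context: The triangular prism graph has vertices $u_A,u_B,u_C,w_A,w_B,w_C$ and edges forming the two triangles $u_Au_Bu_C$ and $w_Aw_Bw_C$ together with the three edges $(u_A,w_A),(u_B,w_B),(u_C,w_C)$. An elongated triangular prism graph is any graph obtained from the triangular prism graph by subdividing (any number of times, possibly zero, independently for each) the edges $(u_A,w_A)$, $(u_B,w_B)$, $(u_C,w_C)$, i.e. replacing each of them by a path. The complement $\overline{G}$ has the same vertex set as $G$, with two distinct vertices adjacent iff they are not adjacent in $G$. Minors are obtained by vertex deletions, edge deletions and edge contractions. *)

theory Defs
  imports "Graph_Theory.Graph_Theory"
begin

(* A finite simple graph is a symmetric, loop-free set of arcs on an explicit finite vertex set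
   (locale pair_graph), so each edge {u,v} is the pair of arcs (u,v) and (v,u). *)

definition complement_graph :: "'a pair_pre_digraph \<Rightarrow> 'a pair_pre_digraph" where
  "complement_graph G =
    \<lparr> pverts = pverts G,
      parcs = {(u, v). u \<in> pverts G \<and> v \<in> pverts G \<and> u \<noteq> v \<and> (u, v) \<notin> parcs G} \<rparr>"

definition delete_vertex :: "'a \<Rightarrow> 'a pair_pre_digraph \<Rightarrow> 'a pair_pre_digraph" where
  "delete_vertex v G =
    \<lparr> pverts = pverts G - {v}, parcs = {e \<in> parcs G. fst e \<noteq> v \<and> snd e \<noteq> v} \<rparr>"

definition delete_edge :: "'a \<times> 'a \<Rightarrow> 'a pair_pre_digraph \<Rightarrow> 'a pair_pre_digraph" where
  "delete_edge e G = \<lparr> pverts = pverts G, parcs = parcs G - {e, prod.swap e} \<rparr>"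

(* The merged vertex keeps the name of the first end. The result is again a simple graph:
   the loop is discarded, and parallel edges coincide in the arc set. *)
definition contract_edge :: "'a \<times> 'a \<Rightarrow> 'a pair_pre_digraph \<Rightarrow> 'a pair_pre_digraph" where
  "contract_edge e G = (let f = (\<lambda>x. if x = snd e then fst e else x) in
    \<lparr> pverts = f ` pverts G,
      parcs = {(f x, f y) | x y. (x, y) \<in> parcs G \<and> f x \<noteq> f y} \<rparr>)"

inductive minor_step :: "'a pair_pre_digraph \<Rightarrow> 'a pair_pre_digraph \<Rightarrow> bool" where
  delete_vertex: "v \<in> pverts G \<Longrightarrow> minor_step G (delete_vertex v G)"
| delete_edge: "e \<in> parcs G \<Longrightarrow> minor_step G (delete_edge e G)"
| contract_edge: "e \<in> parcs G \<Longrightarrow> minor_step G (contract_edge e G)"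

(* Being a complete graph on n vertices (complete_digraph n) is invariant under isomorphism, so no
   explicit isomorphism between the graph H reached and a fixed copy of K_n is needed. *)
definition has_complete_minor :: "nat \<Rightarrow> 'a pair_pre_digraph \<Rightarrow> bool" where
  "has_complete_minor n G \<longleftrightarrow>
    (\<exists>H. minor_step\<^sup>*\<^sup>* G H \<and> complete_digraph n (with_proj H))"

definition triangular_prism ::
  "'a \<Rightarrow> 'a \<Rightarrow> 'a \<Rightarrow> 'a \<Rightarrow> 'a \<Rightarrow> 'a \<Rightarrow> 'a pair_pre_digraph" where
  "triangular_prism uA uB uC wA wB wC =
    (let E = {(uA, uB), (uB, uC), (uC, uA),
              (wA, wB), (wB, wC), (wC, wA),
              (uA, wA), (uB, wB), (uC, wC)}
     in \<lparr> pverts = {uA, uB, uC, wA, wB, wC}, parcs = E \<union> E\<inverse> \<rparr>)"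

(* Repeated subdivision: the edge e = uw is replaced by the path u, x1, ..., xk, w. *)
primrec subdivide_edge ::
  "'a list \<Rightarrow> 'a \<times> 'a \<Rightarrow> 'a pair_pre_digraph \<Rightarrow> 'a pair_pre_digraph" where
  "subdivide_edge [] e G = G"
| "subdivide_edge (x # xs) e G = subdivide_edge xs (x, snd e) (subdivide G e x)"

(* Vertex names are arbitrary, so this predicate is closed under isomorphism. *)
definition elongated_triangular_prism :: "'a pair_pre_digraph \<Rightarrow> bool" where
  "elongated_triangular_prism G \<longleftrightarrow>
    (\<exists>uA uB uC wA wB wC pA pB pC.
      distinct ([uA, uB, uC, wA, wB, wC] @ pA @ pB @ pC) \<and>
      G = subdivide_edge pC (uC, wC) (subdivide_edge pB (uB, wB) (subdivide_edge pA (uA, wA)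
            (triangular_prism uA uB uC wA wB wC))))"

end

theory Submission
  imports Defs "HOL-Library.Disjoint_Sets"
begin

text \<open>
  Let \<open>c\<close> be the first inner vertex of a subdivided edge, say \<open>uC wC\<close>. The three vertices
  \<open>uA\<close>, \<open>wB\<close>, \<open>c\<close> are independent in \<open>G\<close> and become singleton branch sets; the other
  \<open>2n - 6\<close> vertices are grouped into pairs. Such a pair is admissible unless it is in conflict,
  that is, adjacent in \<open>G\<close> or contained in the neighbourhood of one of the three. Two disjoint
  admissible pairs are always joined in the complement, since \<open>G - {uA, wB, c}\<close> is a union of
  paths and has no 4-cycle. In the conflict graph all degrees are at most 3, except for possibly
  one vertex of degree 4, so two degrees sum to at most \<open>7 < 2n - 6\<close>, and an augmentation
  argument in the style of Ore gives a perfect matching of admissible pairs.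
\<close>

section \<open>Complete minors from partitions\<close>

text \<open>The map \<open>r\<close> names the branch sets: each fibre is a star around its fixed
  point, so edges can be contracted into the centre one at a time. The induction is on the number of
  vertices that \<open>r\<close> moves; once all are fixed, the last assumption makes
  \<open>G\<close> complete.\<close>

lemma minor_of_representatives:
  fixes G :: "'a pair_pre_digraph" and r :: "'a \<Rightarrow> 'a"
  assumes "finite (pverts G)"
    and "parcs G \<subseteq> {(u, v). u \<in> pverts G \<and> v \<in> pverts G \<and> u \<noteq> v}"
    and "\<And>v. v \<in> pverts G \<Longrightarrow> r v \<in> pverts G \<and> r (r v) = r v"
    and "\<And>v. v \<in> pverts G \<Longrightarrow> r v \<noteq> v \<Longrightarrow> (r v, v) \<in> parcs G"
    and "\<And>u v. u \<in> pverts G \<Longrightarrow> v \<in> pverts G \<Longrightarrow> r u \<noteq> r v \<Longrightarrow>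
           \<exists>x y. r x = r u \<and> r y = r v \<and> (x, y) \<in> parcs G"
  shows "has_complete_minor (card (r ` pverts G)) G"
  using assms
proof (induction "card {v \<in> pverts G. r v \<noteq> v}" arbitrary: G rule: less_induct)
  case less
  show ?case
  proof (cases "\<exists>v \<in> pverts G. r v \<noteq> v")
    case False
    then have img: "r ` pverts G = pverts G" by auto
    have "(u, v) \<in> parcs G" if uv: "u \<in> pverts G" "v \<in> pverts G" "u \<noteq> v" for u v
    proof -
      have "r u \<noteq> r v" using False uv by auto
      then obtain x y where xy: "r x = r u" "r y = r v" "(x, y) \<in> parcs G"
        using less.prems(5) uv by blast
      then have "x \<in> pverts G" "y \<in> pverts G" using less.prems(2) by auto
      then show ?thesis using xy False uv by auto
    qed
    then have "parcs G = {(u, v). (u, v) \<in> pverts G \<times> pverts G \<and> u \<noteq> v}"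
      using less.prems(2) by auto
    then have "complete_digraph (card (r ` pverts G)) (with_proj G)"
      using less.prems(1) img by (simp add: complete_digraph_pair_def)
    then show ?thesis unfolding has_complete_minor_def by blast
  next
    case True
    then obtain v where v: "v \<in> pverts G" "r v \<noteq> v" by blast
    \<comment> \<open>\<open>contract_edge\<close> keeps the name of the first end, so with
      \<open>r v\<close> in front the same \<open>r\<close> serves for \<open>H\<close>.\<close>
    define H where "H = contract_edge (r v, v) G"
    define f where "f = (\<lambda>x. if x = v then r v else x)"
    have rv: "r v \<in> pverts G" "r (r v) = r v" using less.prems(3) v by auto
    have arcsH: "parcs H = {(f x, f y) | x y. (x, y) \<in> parcs G \<and> f x \<noteq> f y}"
      by (simp add: H_def f_def contract_edge_def Let_def)
    have vertsH: "pverts H = pverts G - {v}"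
      using v rv by (auto simp: H_def contract_edge_def Let_def)
    \<comment> \<open>Values of \<open>r\<close> are fixed points, which \<open>v\<close> is not, so
      no remaining vertex loses its centre.\<close>
    have rne: "r w \<noteq> v" if "w \<in> pverts G" for w
      using less.prems(3)[OF that] v by auto
    have rf: "r (f x) = r x" for x using rv by (simp add: f_def)
    have fv: "f w = w" if "w \<noteq> v" for w using that by (simp add: f_def)
    have img: "r ` pverts H = r ` pverts G"
    proof -
      have "r ` pverts G = r ` insert v (pverts H)" using v by (simp add: vertsH insert_absorb)
      moreover have "r v \<in> r ` pverts H"
        using v rv by (intro image_eqI[of _ _ "r v"]) (auto simp: vertsH)
      ultimately show ?thesis by auto
    qed
    have "minor_step G H"
      unfolding H_def using less.prems(4) v by (intro minor_step.contract_edge) auto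
    moreover have "has_complete_minor (card (r ` pverts H)) H"
    proof (rule less.hyps)
      show "card {w \<in> pverts H. r w \<noteq> w} < card {w \<in> pverts G. r w \<noteq> w}"
        using less.prems(1) v by (intro psubset_card_mono) (auto simp: vertsH)
      show "finite (pverts H)" using less.prems(1) vertsH by simp
      show "parcs H \<subseteq> {(u, v). u \<in> pverts H \<and> v \<in> pverts H \<and> u \<noteq> v}"
        using less.prems(2) v rv by (auto simp: arcsH vertsH f_def)
      show "r w \<in> pverts H \<and> r (r w) = r w" if "w \<in> pverts H" for w
        using that less.prems(3) rne by (auto simp: vertsH)
      show "(r w, w) \<in> parcs H" if "w \<in> pverts H" "r w \<noteq> w" for w
      proof -
        have "(r w, w) \<in> parcs G" "w \<noteq> v" "r w \<noteq> v"
          using that less.prems(4) rne by (auto simp: vertsH)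
        then show ?thesis
          using that(2) fv unfolding arcsH by (intro CollectI exI[of _ "r w"] exI[of _ w]) simp
      qed
      show "\<exists>x y. r x = r u \<and> r y = r w \<and> (x, y) \<in> parcs H"
        if uw: "u \<in> pverts H" "w \<in> pverts H" "r u \<noteq> r w" for u w
      proof -
        obtain x y where xy: "r x = r u" "r y = r w" "(x, y) \<in> parcs G"
          using less.prems(5)[of u w] uw by (auto simp: vertsH)
        \<comment> \<open>\<open>f\<close> moves vertices only within their fibre, so an arc between
          different fibres does not collapse to a loop.\<close>
        then have "f x \<noteq> f y" using uw(3) rf by metis
        then have "(f x, f y) \<in> parcs H" using xy by (auto simp: arcsH)
        then show ?thesis using xy rf by metis
      qed
    qed
    ultimately show ?thesis
      unfolding has_complete_minor_def img by (meson converse_rtranclp_into_rtranclp)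
  qed
qed

text \<open>The blocks become branch sets: a vertex whose block mates are all non-neighbours in
  \<open>G\<close> is the centre of a star in the complement. The bijection \<open>h\<close> lets
  the partition live on indices.\<close>

lemma complement_minor_of_partition:
  fixes G :: "'a pair_pre_digraph" and h :: "'i \<Rightarrow> 'a"
  assumes fin: "finite (pverts G)" and h: "bij_betw h I (pverts G)"
    and part: "partition_on I P"
    and star: "\<And>B. B \<in> P \<Longrightarrow> \<exists>i\<in>B. \<forall>j\<in>B. j \<noteq> i \<longrightarrow> (h i, h j) \<notin> parcs G"
    and link: "\<And>B C. B \<in> P \<Longrightarrow> C \<in> P \<Longrightarrow> B \<noteq> C \<Longrightarrow> \<exists>i\<in>B. \<exists>j\<in>C. (h i, h j) \<notin> parcs G"
  shows "has_complete_minor (card P) (complement_graph G)"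
proof -
  define G' where "G' = complement_graph G"
  have V: "pverts G' = h ` I"
    using h by (auto simp: G'_def complement_graph_def bij_betw_def)
  have inj: "inj_on h I" using h by (simp add: bij_betw_def)
  have arc: "(h i, h j) \<in> parcs G' \<longleftrightarrow> i \<noteq> j \<and> (h i, h j) \<notin> parcs G"
    if "i \<in> I" "j \<in> I" for i j
    using that h inj by (auto simp: G'_def complement_graph_def bij_betw_def inj_on_eq_iff)
  obtain c where c: "\<And>B. B \<in> P \<Longrightarrow> c B \<in> B \<and> (\<forall>j\<in>B. j \<noteq> c B \<longrightarrow> (h (c B), h j) \<notin> parcs G)"
    using star by metis
  have PI: "i \<in> I" if "i \<in> B" "B \<in> P" for i B
    using that partition_onD1[OF part] by auto
  have uniq: "B = C" if "i \<in> B" "B \<in> P" "i \<in> C" "C \<in> P" for i B C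
    using that partition_onD2[OF part] by (auto simp: disjoint_def)
  define b where "b = (\<lambda>i. THE B. B \<in> P \<and> i \<in> B)"
  have b: "b i = B" if "i \<in> B" "B \<in> P" for i B
    unfolding b_def using that uniq by (intro the_equality) auto
  \<comment> \<open>The retraction passes from a vertex to its index, to its block, and to the
    centre of that block.\<close>
  define r where "r = (\<lambda>v. h (c (b (inv_into I h v))))"
  have r: "r (h i) = h (c B)" if "i \<in> B" "B \<in> P" for i B
    using that inj PI b by (simp add: r_def)
  have ex: "\<exists>B\<in>P. \<exists>i\<in>B. v = h i" if "v \<in> pverts G'" for v
    using that partition_onD1[OF part] by (auto simp: V)
  have "has_complete_minor (card (r ` pverts G')) G'"
  proof (rule minor_of_representatives)
    show "finite (pverts G')" using fin by (simp add: G'_def complement_graph_def)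
    show "parcs G' \<subseteq> {(u, v). u \<in> pverts G' \<and> v \<in> pverts G' \<and> u \<noteq> v}"
      by (auto simp: G'_def complement_graph_def)
    show "r v \<in> pverts G' \<and> r (r v) = r v" if v: "v \<in> pverts G'" for v
    proof -
      obtain B i where B: "B \<in> P" "i \<in> B" "v = h i" using ex[OF v] by blast
      then have "c B \<in> B" "c B \<in> I" using c PI by auto
      then show ?thesis using B r V by auto
    qed
    show "(r v, v) \<in> parcs G'" if v: "v \<in> pverts G'" "r v \<noteq> v" for v
    proof -
      obtain B i where "B \<in> P" "i \<in> B" "v = h i" using ex[OF v(1)] by blast
      then show ?thesis using v(2) c[of B] r[of i B] PI arc[of "c B" i] by auto
    qed
    show "\<exists>x y. r x = r u \<and> r y = r v \<and> (x, y) \<in> parcs G'"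
      if uv: "u \<in> pverts G'" "v \<in> pverts G'" "r u \<noteq> r v" for u v
    proof -
      obtain B i where B: "B \<in> P" "i \<in> B" "u = h i" using ex[OF uv(1)] by blast
      obtain C j where C: "C \<in> P" "j \<in> C" "v = h j" using ex[OF uv(2)] by blast
      have "B \<noteq> C" using B C r uv(3) by auto
      then obtain k l where kl: "k \<in> B" "l \<in> C" "(h k, h l) \<notin> parcs G"
        using link B C by blast
      then have "(h k, h l) \<in> parcs G'"
        using arc[of k l] PI B C uniq \<open>B \<noteq> C\<close> by blast
      moreover have "r (h k) = r u" "r (h l) = r v" using kl B C r by auto
      ultimately show ?thesis by blast
    qed
  qed
  moreover have "r ` pverts G' = (\<lambda>B. h (c B)) ` P"
  proof
    show "r ` pverts G' \<subseteq> (\<lambda>B. h (c B)) ` P" using ex r by fastforce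
    show "(\<lambda>B. h (c B)) ` P \<subseteq> r ` pverts G'"
    proof
      fix v assume "v \<in> (\<lambda>B. h (c B)) ` P"
      then obtain B where "B \<in> P" "v = h (c B)" by blast
      moreover from this have "c B \<in> B" "c B \<in> I" using c PI by auto
      ultimately have "v = r (h (c B))" "h (c B) \<in> pverts G'" using r V by auto
      then show "v \<in> r ` pverts G'" by blast
    qed
  qed
  moreover have "inj_on (\<lambda>B. h (c B)) P"
    using c PI uniq inj by (intro inj_onI) (metis inj_on_eq_iff)
  ultimately show ?thesis by (simp add: card_image G'_def)
qed

section \<open>Perfect matchings in the complement\<close>

text \<open>Start from a maximum matching \<open>M\<close>. Two uncovered vertices conflict with all
  other uncovered ones and jointly have at least two conflicts with each edge of \<open>M\<close>,
  so their degrees sum to at least \<open>2 * (card U - 1) + 2 * card M\<close>, which is at least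
  \<open>card V\<close>.\<close>

lemma complement_perfect_matching:
  fixes V :: "'a set" and K :: "'a \<Rightarrow> 'a \<Rightarrow> bool"
  assumes fin: "finite V" and even: "even (card V)" and sym: "\<And>x y. K x y \<Longrightarrow> K y x"
    and deg: "\<And>x y. x \<in> V \<Longrightarrow> y \<in> V \<Longrightarrow> x \<noteq> y \<Longrightarrow>
      card {z \<in> V. z \<noteq> x \<and> K x z} + card {z \<in> V. z \<noteq> y \<and> K y z} < card V"
  shows "\<exists>M. partition_on V M \<and> (\<forall>e\<in>M. \<exists>x y. x \<noteq> y \<and> e = {x, y} \<and> \<not> K x y)"
proof -
  define E where "E = {{x, y} | x y. x \<in> V \<and> y \<in> V \<and> x \<noteq> y \<and> \<not> K x y}"
  define matching where "matching = (\<lambda>M. M \<subseteq> E \<and> disjoint M)"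
  have E: "e \<subseteq> V" "card e = 2" if "e \<in> E" for e using that by (auto simp: E_def)
  have finE: "finite E" using fin E(1) by (intro finite_subset[of E "Pow V"]) auto
  have "matching {}" by (simp add: matching_def)
  moreover have "\<forall>M. matching M \<longrightarrow> card M < Suc (card E)"
    using finE by (auto simp: matching_def less_Suc_eq_le intro: card_mono)
  ultimately obtain M where M: "matching M" and max: "\<And>M'. matching M' \<Longrightarrow> card M' \<le> card M"
    using ex_has_greatest_nat[of matching "{}" card "Suc (card E)"] by blast
  have ME: "M \<subseteq> E" and disj: "disjoint M" using M by (auto simp: matching_def)
  have finM: "finite M" using ME finE finite_subset by blast
  have MV: "\<Union>M \<subseteq> V" using ME E(1) by blast
  have cardU: "card (\<Union>M) = 2 * card M"
  proof -
    have "card (\<Union>M) = sum card M"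
      using disj ME E(1) fin by (intro card_Union_disjoint) (auto intro: finite_subset)
    also have "\<dots> = 2 * card M" using ME E(2) by (simp add: subset_eq)
    finally show ?thesis .
  qed
  define U where "U = V - \<Union>M"
  have "U = {}"
  proof (rule ccontr)
    assume "U \<noteq> {}"
    have cU: "card U + 2 * card M = card V"
      using card_Diff_subset[of "\<Union>M" V] card_mono[OF fin MV] cardU MV fin finite_subset[OF MV fin]
      by (simp add: U_def)
    have "card U \<noteq> 0" using \<open>U \<noteq> {}\<close> fin by (simp add: U_def)
    \<comment> \<open>Parity turns one uncovered vertex into two.\<close>
    moreover have "even (card U)" using cU even by (metis dvd_triv_left even_add)
    ultimately have "2 \<le> card U" by presburger
    then obtain x y where xy: "x \<in> U" "y \<in> U" "x \<noteq> y"
      by (metis card_le_Suc0_iff_eq finite_Diff U_def fin not_less_eq_eq numeral_2_eq_2)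
    \<comment> \<open>Otherwise \<open>{u, v}\<close> could be added to \<open>M\<close>.\<close>
    have UK: "K u v" if uv: "u \<in> U" "v \<in> U" "u \<noteq> v" for u v
    proof (rule ccontr)
      assume "\<not> K u v"
      then have new: "{u, v} \<in> E" using uv by (auto simp: E_def U_def)
      have "{u, v} \<notin> M" using uv by (auto simp: U_def)
      moreover have "matching (insert {u, v} M)"
        using new ME disj uv by (auto simp: matching_def U_def pairwise_insert disjnt_def)
      ultimately show False using max[of "insert {u, v} M"] finM by simp
    qed
    define N where "N = (\<lambda>u. {z \<in> V. z \<noteq> u \<and> K u z})"
    have finN: "finite (N u)" for u using fin by (simp add: N_def)
    have two: "2 \<le> card (N x \<inter> e) + card (N y \<inter> e)" if e: "e \<in> M" for e
    proof -
      obtain p q where pq: "e = {p, q}" "p \<in> V" "q \<in> V" "p \<noteq> q"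
        using e ME by (auto simp: E_def)
      have ne: "p \<noteq> x" "p \<noteq> y" "q \<noteq> x" "q \<noteq> y" using xy pq e by (auto simp: U_def)
      \<comment> \<open>Used for both orderings of \<open>e\<close>: each of the two ways of joining
        \<open>x\<close> and \<open>y\<close> to the ends of \<open>e\<close> meets a conflict, and
        the two ways share no pair.\<close>
      have aug: "K x p' \<or> K y q'" if pq': "{p', q'} = e" for p' q'
      proof (rule ccontr)
        assume no: "\<not> (K x p' \<or> K y q')"
        \<comment> \<open>Augmentation along the path \<open>x\<close>, \<open>p'\<close>,
          \<open>q'\<close>, \<open>y\<close>: the edge \<open>e\<close> is traded for two
          pairs.\<close>
        define M' where "M' = insert {x, p'} (insert {y, q'} (M - {e}))"
        have p'q': "p' \<noteq> q'" "p' \<in> V" "q' \<in> V" "p' \<in> e" "q' \<in> e"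
            "p' \<noteq> x" "p' \<noteq> y" "q' \<noteq> x" "q' \<noteq> y"
          using pq' pq ne by (auto simp: doubleton_eq_iff)
        have "{x, p'} \<in> E" "{y, q'} \<in> E"
          using no p'q' xy by (auto simp: E_def U_def)
        moreover have out: "p' \<notin> f" "q' \<notin> f" "x \<notin> f" "y \<notin> f" if "f \<in> M - {e}" for f
          using that disj e p'q' xy by (auto simp: disjoint_def U_def)
        ultimately have "matching M'"
          using ME pairwise_subset[OF disj Diff_subset] xy p'q'
          by (auto simp: matching_def M'_def pairwise_insert disjnt_def)
        moreover have "card M' = card M + 1"
        proof -
          have "{x, p'} \<notin> insert {y, q'} (M - {e})" "{y, q'} \<notin> M - {e}"
            using out xy p'q' by (auto simp: doubleton_eq_iff)
          then show ?thesis
            using finM card_Suc_Diff1[OF finM e] by (simp add: M'_def)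
        qed
        ultimately show False using max by fastforce
      qed
      have "card (N x \<inter> e) = of_bool (K x p) + of_bool (K x q)"
        and "card (N y \<inter> e) = of_bool (K y p) + of_bool (K y q)"
        using pq ne by (auto simp: N_def Int_insert_right)
      moreover have "K x p \<or> K y q" "K x q \<or> K y p"
        using aug pq(1) by (auto simp: insert_commute)
      ultimately show ?thesis by auto
    qed
    \<comment> \<open>By \<open>UK\<close> an uncovered vertex conflicts with every other uncovered
      one; its remaining conflicts split along the disjoint edges of \<open>M\<close>.\<close>
    have count: "card (N u) = card U - 1 + (\<Sum>e\<in>M. card (N u \<inter> e))" if u: "u \<in> U" for u
    proof -
      have "N u = (U - {u}) \<union> (\<Union>e\<in>M. N u \<inter> e)"
        using UK u by (auto simp: N_def U_def)
      then have "card (N u) = card ((U - {u}) \<union> (\<Union>e\<in>M. N u \<inter> e))" by simp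
      also have "\<dots> = card (U - {u}) + card (\<Union>e\<in>M. N u \<inter> e)"
        using fin finM finN by (intro card_Un_disjoint) (auto simp: U_def)
      also have "card (\<Union>e\<in>M. N u \<inter> e) = (\<Sum>e\<in>M. card (N u \<inter> e))"
        using finM finN disj by (intro card_UN_disjoint) (auto simp: disjoint_def)
      finally show ?thesis using u fin by (simp add: U_def)
    qed
    have "2 * card M \<le> (\<Sum>e\<in>M. card (N x \<inter> e) + card (N y \<inter> e))"
      using sum_bounded_below[of M 2, OF two] by (simp add: mult.commute)
    then have "2 * card M + 2 * (card U - 1) \<le> card (N x) + card (N y)"
      using count xy by (simp add: sum.distrib)
    moreover have "card (N x) + card (N y) < card V"
      using deg xy by (simp add: N_def U_def)
    ultimately show False using cU \<open>2 \<le> card U\<close> by linarith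
  qed
  then have "partition_on V M"
    using MV disj ME by (auto simp: partition_on_def U_def E_def)
  moreover have "\<exists>x y. x \<noteq> y \<and> e = {x, y} \<and> \<not> K x y" if "e \<in> M" for e
    using that ME unfolding E_def by blast
  ultimately show ?thesis by blast
qed

section \<open>The conflict graph\<close>

text \<open>
  In an elongated prism with path vertices \<open>pA\<close>, \<open>pB\<close>, \<open>pC = c # p\<close>, the index \<open>i < N\<close> stands for the
  \<open>i\<close>-th entry of \<open>[uC, uB] @ pB @ pA @ [wA, wC] @ rev p\<close>; \<open>s\<close> is the index of the last entry
  before \<open>pA\<close> and \<open>t\<close> that of \<open>wA\<close>. Without \<open>uA\<close>, \<open>wB\<close>, \<open>c\<close> (indices \<open>N\<close>, \<open>N + 1\<close>, \<open>N + 2\<close>)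
  the graph is the union of the two paths \<open>0, \<dots>, s\<close> and \<open>s + 1, \<dots>, N - 1\<close>.
\<close>

definition prism_arc :: "nat \<Rightarrow> nat \<Rightarrow> nat \<Rightarrow> nat \<Rightarrow> nat \<Rightarrow> bool" where
  "prism_arc N s t i j \<longleftrightarrow>
    j = Suc i \<and> j < N \<and> i \<noteq> s \<or>
    i = N \<and> j \<in> {0, 1, s + 1} \<or>
    i = N + 1 \<and> j \<in> {s, t, t + 1} \<or>
    i = N + 2 \<and> j \<in> {0, N - 1}"

definition prism_adj :: "nat \<Rightarrow> nat \<Rightarrow> nat \<Rightarrow> nat \<Rightarrow> nat \<Rightarrow> bool" where
  "prism_adj N s t i j \<longleftrightarrow> prism_arc N s t i j \<or> prism_arc N s t j i"

text \<open>These pairs are unfit as branch sets: adjacent ones are disconnected in the complement,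
  and those inside the neighbourhood of some \<open>k\<close> have no link to the singleton
  \<open>{k}\<close>.\<close>

definition prism_conflict :: "nat \<Rightarrow> nat \<Rightarrow> nat \<Rightarrow> nat \<Rightarrow> nat \<Rightarrow> bool" where
  "prism_conflict N s t i j \<longleftrightarrow>
    prism_adj N s t i j \<or> (\<exists>k \<in> {N, N + 1, N + 2}. prism_adj N s t k i \<and> prism_adj N s t k j)"

lemma prism_adj_iff:
  assumes "1 \<le> s" "s < t" "t + 2 \<le> N" "j < N"
  shows "i < N \<Longrightarrow> prism_adj N s t i j \<longleftrightarrow> j = Suc i \<and> i \<noteq> s \<or> i = Suc j \<and> j \<noteq> s"
    and "prism_adj N s t N j \<longleftrightarrow> j \<in> {0, 1, Suc s}"
    and "prism_adj N s t (N + 1) j \<longleftrightarrow> j \<in> {s, t, Suc t}"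
    and "prism_adj N s t (N + 2) j \<longleftrightarrow> j \<in> {0, N - 1}"
  using assms by (simp_all add: prism_adj_def prism_arc_def) linarith?

text \<open>A corner adjacent to both \<open>uA\<close> and \<open>wB\<close> collects two partners
  from each neighbourhood: this is \<open>uB\<close> if \<open>pB\<close> is empty, and
  \<open>wA\<close> if \<open>pA\<close> is empty. If both are empty, each of them is a partner of
  the other twice over, and the bound drops back to 3.\<close>

lemma prism_conflict_degree:
  assumes st: "1 \<le> s" "s < t" "t + 2 \<le> N" and i: "i < N"
  shows "card {j \<in> {..<N}. j \<noteq> i \<and> prism_conflict N s t i j} \<le>
    3 + of_bool (i = 1 \<and> s = 1 \<and> t \<noteq> 2 \<or> i = t \<and> t = s + 1 \<and> s \<noteq> 1)"
proof -
  obtain N' where N: "N = Suc N'" using st by (cases N) auto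
  define C where "C = {j \<in> {..<N}. j \<noteq> i \<and> prism_conflict N s t i j}"
  \<comment> \<open>A superset of the partners of \<open>i\<close>: path neighbours, with the break
    between \<open>s\<close> and \<open>s + 1\<close>, then partners through \<open>N\<close>,
    \<open>N + 1\<close>, \<open>N + 2\<close>. The pairs \<open>0\<close>, \<open>1\<close> and
    \<open>t\<close>, \<open>t + 1\<close> are already covered as path neighbours.\<close>
  define D where "D = (if i = s \<or> i = N' then {} else {Suc i}) \<union>
    (if i = 0 \<or> i = Suc s then {} else {i - 1}) \<union>
    (if i = 0 then {N', Suc s} else {}) \<union> (if i = N' then {0} else {}) \<union>
    (if i = Suc s then {0, 1} else {}) \<union> (if i = 1 then {Suc s} else {}) \<union>
    (if i = s then {t, Suc t} else {}) \<union> (if i = t \<or> i = Suc t then {s} else {})"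
  have C: "j \<in> D" if "j \<in> C" for j
  proof -
    have j: "j < N" "j \<noteq> i" "prism_conflict N s t i j" using that by (auto simp: C_def)
    have adj: "prism_adj N s t i j \<longleftrightarrow> j = Suc i \<and> i \<noteq> s \<or> i = Suc j \<and> j \<noteq> s"
      using prism_adj_iff(1)[OF st j(1) i] .
    note iff = prism_adj_iff(2-4)[OF st i] prism_adj_iff(2-4)[OF st j(1)]
    have "N - 1 = N'" by (simp add: N)
    moreover have "prism_adj N s t i j \<or> prism_adj N s t N i \<and> prism_adj N s t N j \<or>
        prism_adj N s t (N + 1) i \<and> prism_adj N s t (N + 1) j \<or>
        prism_adj N s t (N + 2) i \<and> prism_adj N s t (N + 2) j"
      using j(3) unfolding prism_conflict_def by blast
    ultimately consider "prism_adj N s t i j" | "i \<in> {0, 1, Suc s}" "j \<in> {0, 1, Suc s}"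
      | "i \<in> {s, t, Suc t}" "j \<in> {s, t, Suc t}" | "i \<in> {0, N'}" "j \<in> {0, N'}"
      unfolding iff by metis
    then show ?thesis
    proof cases
      case 1
      then have "j = Suc i \<and> i \<noteq> s \<or> i = Suc j \<and> j \<noteq> s" using adj by simp
      then show ?thesis using j(1) by (elim disjE conjE) (simp_all add: D_def N)
    next
      case 2
      then show ?thesis using j(2) st by (elim insertE) (simp_all add: D_def N)
    next
      case 3
      then show ?thesis using j(2) st by (elim insertE) (simp_all add: D_def N)
    next
      case 4
      then show ?thesis using j(2) st by (elim insertE) (simp_all add: D_def N)
    qed
  qed
  \<comment> \<open>Only the length of the list counts, so entries that coincide for some
    \<open>s\<close> and \<open>t\<close> do no harm.\<close>
  have bound: "card C \<le> length js" if "D \<subseteq> set js" for js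
  proof -
    have "C \<subseteq> set js" using C that by blast
    then show ?thesis using card_mono[of "set js" C] card_length[of js] by simp
  qed
  \<comment> \<open>The cases may overlap; only \<open>e\<close> and \<open>k\<close> need four
    candidates. Case \<open>m'\<close> is \<open>wC\<close> when \<open>p\<close> is empty, so that
    \<open>wC\<close> ends its path.\<close>
  consider (a) "i = 0" | (b) "i = N'" "i \<noteq> t + 1" | (c) "i = 1" "s \<noteq> 1" | (d) "i = 1" "s = 1" "t = 2" |
    (e) "i = 1" "s = 1" "t \<noteq> 2" | (f) "i = s" "i \<noteq> 1" | (g) "i = s + 1" "t \<noteq> s + 1" |
    (h) "i = s + 1" "t = s + 1" "s = 1" | (k) "i = s + 1" "t = s + 1" "s \<noteq> 1" | (l) "i = t" "i \<noteq> s + 1" |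
    (m) "i = t + 1" "i \<noteq> N'" | (m') "i = t + 1" "i = N'" |
    (n) "i \<noteq> 0" "i \<noteq> N'" "i \<noteq> 1" "i \<noteq> s" "i \<noteq> s + 1" "i \<noteq> t" "i \<noteq> t + 1"
    by satx
  then have "card C \<le> 3 + of_bool (i = 1 \<and> s = 1 \<and> t \<noteq> 2 \<or> i = t \<and> t = s + 1 \<and> s \<noteq> 1)"
  proof cases
    case a
    have "D \<subseteq> set [1, N', s + 1]" using st a by (simp add: N D_def)
    from bound[OF this] show ?thesis using st i a by simp
  next
    case b
    have "D \<subseteq> set [N' - 1, 0]" using st b by (simp add: N D_def)
    from bound[OF this] show ?thesis by simp
  next
    case c
    have "D \<subseteq> set [0, 2, s + 1]" using st c by (simp add: N D_def)
    from bound[OF this] show ?thesis by simp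
  next
    case d
    have "D \<subseteq> set [0, t, t + 1]" using st d by (simp add: N D_def)
    from bound[OF this] show ?thesis by simp
  next
    case e
    have "D \<subseteq> set [0, s + 1, t, t + 1]" using st e by (simp add: N D_def)
    from bound[OF this] show ?thesis using e by simp
  next
    case f
    have "D \<subseteq> set [i - 1, t, t + 1]" using st f by (simp add: N D_def)
    from bound[OF this] show ?thesis by simp
  next
    case g
    have "D \<subseteq> set [s + 2, 0, 1]" using st g by (simp add: N D_def)
    from bound[OF this] show ?thesis by simp
  next
    case h
    have "D \<subseteq> set [t + 1, 0, 1]" using st h by (simp add: N D_def)
    from bound[OF this] show ?thesis by simp
  next
    case k
    have "D \<subseteq> set [t + 1, 0, 1, s]" using st k by (simp add: N D_def)
    from bound[OF this] show ?thesis using k by simp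
  next
    case l
    have "D \<subseteq> set [i - 1, t + 1, s]" using st l by (simp add: N D_def)
    from bound[OF this] show ?thesis by simp
  next
    case m
    have "D \<subseteq> set [t, t + 2, s]" using st m by (simp add: N D_def)
    from bound[OF this] show ?thesis by simp
  next
    case m'
    have "D \<subseteq> set [t, 0, s]" using st m' by (simp add: N D_def)
    from bound[OF this] show ?thesis by simp
  next
    case n
    have "D \<subseteq> set [i - 1, i + 1]" using st n by (simp add: N D_def)
    from bound[OF this] show ?thesis by simp
  qed
  then show ?thesis by (simp add: C_def)
qed

section \<open>Branch sets on the indices: three singletons and a perfect matching of the
  rest\<close>

lemma prism_partition:
  assumes st: "1 \<le> s" "s < t" "t + 2 \<le> N" and N: "8 \<le> N" "even N"
  shows "\<exists>P. partition_on {..<N + 3} P \<and> card P = N div 2 + 3 \<and>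
    (\<forall>B\<in>P. \<exists>i\<in>B. \<forall>j\<in>B. j \<noteq> i \<longrightarrow> \<not> prism_adj N s t i j) \<and>
    (\<forall>B\<in>P. \<forall>C\<in>P. B \<noteq> C \<longrightarrow> (\<exists>i\<in>B. \<exists>j\<in>C. \<not> prism_adj N s t i j))"
proof -
  let ?A = "prism_adj N s t" and ?K = "prism_conflict N s t"
  have symA: "?A i j \<longleftrightarrow> ?A j i" for i j unfolding prism_adj_def by blast
  have symK: "?K i j \<Longrightarrow> ?K j i" for i j using symA[of i j] unfolding prism_conflict_def by blast
  have "card {k \<in> {..<N}. k \<noteq> i \<and> ?K i k} + card {k \<in> {..<N}. k \<noteq> j \<and> ?K j k} < card {..<N}"
    if "i \<in> {..<N}" "j \<in> {..<N}" "i \<noteq> j" for i j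
  proof -
    define big where "big = (\<lambda>i. i = 1 \<and> s = 1 \<and> t \<noteq> 2 \<or> i = t \<and> t = s + 1 \<and> s \<noteq> 1)"
    define d where "d = (\<lambda>i. card {k \<in> {..<N}. k \<noteq> i \<and> ?K i k})"
    \<comment> \<open>The two alternatives in \<open>big\<close> contradict each other and each
      determines its index, so at most one index is exceptional. The degrees then sum to at most 7,
      and \<open>8 \<le> N\<close>.\<close>
    have "\<not> big i \<or> \<not> big j" using that(3) unfolding big_def by presburger
    then have "of_bool (big i) + of_bool (big j) \<le> (1::nat)" by auto
    moreover have "d i \<le> 3 + of_bool (big i)" "d j \<le> 3 + of_bool (big j)"
      unfolding d_def big_def using prism_conflict_degree[OF st] that by blast+
    ultimately have "d i + d j < N" using N(1) by linarith
    then show ?thesis by (simp add: d_def)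
  qed
  then obtain M where M: "partition_on {..<N} M"
    and pairs: "\<And>e. e \<in> M \<Longrightarrow> \<exists>x y. x \<noteq> y \<and> e = {x, y} \<and> \<not> ?K x y"
    using complement_perfect_matching[of "{..<N}" ?K] N(2) symK by auto
  have sub: "e \<subseteq> {..<N}" if "e \<in> M" for e using partition_onD1[OF M] that by blast
  have cardM: "2 * card M = N"
  proof -
    have "N = card (\<Union>M)" using partition_onD1[OF M] by (metis card_lessThan)
    also have "\<dots> = sum card M"
      using partition_onD2[OF M] sub by (intro card_Union_disjoint) (auto intro: finite_subset)
    also have "\<dots> = (\<Sum>e\<in>M. 2)"
      using pairs by (intro sum.cong) (auto dest!: pairs)
    finally show ?thesis by simp
  qed
  define S where "S = {{N}, {N + 1}, {N + 2}}"
  have S: "B \<in> S \<longleftrightarrow> (\<exists>k\<in>{N, N + 1, N + 2}. B = {k})" for B by (auto simp: S_def)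
  have finM: "finite M" using M finite_elements by blast
  have disjSM: "S \<inter> M = {}" using sub by (fastforce simp: S)
  have indep: "\<not> ?A k l" if "k \<in> {N, N + 1, N + 2}" "l \<in> {N, N + 1, N + 2}" for k l
    using that st by (auto simp: prism_adj_def prism_arc_def)
  \<comment> \<open>A pair free of conflict is not contained in the neighbourhood of
    \<open>k\<close>.\<close>
  have SM: "\<exists>i\<in>e. \<not> ?A k i" if k: "k \<in> {N, N + 1, N + 2}" and e: "e \<in> M" for k e
    using pairs[OF e] k by (auto simp: prism_conflict_def)
  have MM: "\<exists>i\<in>e. \<exists>j\<in>f. \<not> ?A i j" if e: "e \<in> M" and f: "f \<in> M" for e f
  proof (rule ccontr)
    assume all: "\<not> ?thesis"
    obtain p q where pq: "p \<noteq> q" "e = {p, q}" using pairs e by blast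
    obtain p' q' where pq': "p' \<noteq> q'" "f = {p', q'}" using pairs f by blast
    \<comment> \<open>Adjacent indices below \<open>N\<close> are consecutive numbers. If all four
      adjacencies held, \<open>p'\<close> and \<open>q'\<close> would be the two numbers next to
      \<open>p\<close> and also the two next to \<open>q\<close>, forcing
      \<open>p = q\<close>.\<close>
    have step: "j = Suc i \<or> i = Suc j" if "i \<in> e" "j \<in> f" for i j
    proof -
      have "?A i j" "i < N" "j < N" using all that sub e f by auto
      then show ?thesis by (auto simp: prism_adj_def prism_arc_def)
    qed
    show False using step[of p p'] step[of p q'] step[of q p'] step[of q q'] pq pq' by auto
  qed
  have "partition_on {..<N + 3} (S \<union> M)"
  proof -
    have "\<Union>S = {N, N + 1, N + 2}" by (auto simp: S_def)
    then have "\<Union>(S \<union> M) = {N, N + 1, N + 2} \<union> {..<N}"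
      using partition_onD1[OF M] by simp
    also have "\<dots> = {..<N + 3}" by auto
    finally have un: "\<Union>(S \<union> M) = {..<N + 3}" .
    show ?thesis
    proof (rule partition_onI[OF un])
      show "disjnt B C" if "B \<in> S \<union> M" "C \<in> S \<union> M" "B \<noteq> C" for B C
        using that partition_onD2[OF M] sub
        by (fastforce simp: S disjnt_def disjoint_def)
      show "{} \<notin> S \<union> M" using partition_onD3[OF M] by (simp add: S)
    qed
  qed
  moreover have "card (S \<union> M) = N div 2 + 3"
    using card_Un_disjoint[OF _ finM disjSM] cardM by (simp add: S_def)
  moreover have "\<exists>i\<in>B. \<forall>j\<in>B. j \<noteq> i \<longrightarrow> \<not> ?A i j" if "B \<in> S \<union> M" for B
  proof (cases "B \<in> S")
    case True
    then show ?thesis unfolding S by blast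
  next
    case False
    then have "B \<in> M" using that by simp
    from pairs[OF this] obtain x y where "B = {x, y}" "\<not> ?K x y" by blast
    then have "\<not> ?A x y" by (simp add: prism_conflict_def)
    with \<open>B = {x, y}\<close> show ?thesis by auto
  qed
  moreover have "\<exists>i\<in>B. \<exists>j\<in>C. \<not> ?A i j" if BC: "B \<in> S \<union> M" "C \<in> S \<union> M" for B C
  proof -
    consider k l where "k \<in> {N, N + 1, N + 2}" "l \<in> {N, N + 1, N + 2}" "B = {k}" "C = {l}"
      | k where "k \<in> {N, N + 1, N + 2}" "B = {k}" "C \<in> M"
      | l where "l \<in> {N, N + 1, N + 2}" "C = {l}" "B \<in> M"
      | "B \<in> M" "C \<in> M"
      using BC unfolding Un_iff S by blast
    then show ?thesis
    proof cases
      case 1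
      then show ?thesis using indep by blast
    next
      case 2
      then show ?thesis using SM[of _ C] by blast
    next
      case 3
      then obtain i where "i \<in> B" "\<not> ?A l i" using SM[of l B] by blast
      then show ?thesis using 3 symA[of l i] by blast
    next
      case 4
      then show ?thesis using MM by blast
    qed
  qed
  ultimately show ?thesis by blast
qed

section \<open>Labelling an elongated prism\<close>

definition path_arcs :: "'a list \<Rightarrow> ('a \<times> 'a) set" where
  "path_arcs xs = {(xs ! i, xs ! Suc i) | i. Suc i < length xs}"

lemma path_arcs_Cons: "path_arcs (x # y # xs) = insert (x, y) (path_arcs (y # xs))"
proof -
  show ?thesis
    unfolding path_arcs_def
  proof (intro equalityI subsetI)
    fix e assume "e \<in> {((x # y # xs) ! i, (x # y # xs) ! Suc i) | i. Suc i < length (x # y # xs)}"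
    then obtain i where i: "e = ((x # y # xs) ! i, (x # y # xs) ! Suc i)" "Suc i < length (x # y # xs)"
      by blast
    then show "e \<in> insert (x, y) {((y # xs) ! i, (y # xs) ! Suc i) | i. Suc i < length (y # xs)}"
      by (cases i) auto
  next
    fix e assume "e \<in> insert (x, y) {((y # xs) ! i, (y # xs) ! Suc i) | i. Suc i < length (y # xs)}"
    then consider "e = (x, y)" | i where "e = ((y # xs) ! i, (y # xs) ! Suc i)" "Suc i < length (y # xs)"
      by blast
    then show "e \<in> {((x # y # xs) ! i, (x # y # xs) ! Suc i) | i. Suc i < length (x # y # xs)}"
    proof cases
      case 1 then show ?thesis by (auto intro!: exI[of _ 0])
    next
      case (2 i) then show ?thesis by (auto intro!: exI[of _ "Suc i"])
    qed
  qed
qed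

lemma pverts_subdivide_edge: "pverts (subdivide_edge xs e G) = pverts G \<union> set xs"
proof (induction xs arbitrary: e G)
  case (Cons x xs)
  then show ?case by (cases e) (simp add: subdivide.simps)
qed simp

text \<open>Each subdivision adds an arc from the new vertex on to \<open>w\<close>, which the next
  round replaces in turn. An inclusion is enough, since only non-arcs of \<open>G\<close> are used
  later.\<close>

lemma parcs_subdivide_edge:
  "parcs (subdivide_edge xs (u, w) G) \<subseteq>
    (parcs G - {(u, w), (w, u)}) \<union> (path_arcs (u # xs @ [w]) \<union> (path_arcs (u # xs @ [w]))\<inverse>)"
proof (induction xs arbitrary: u G)
  case Nil
  show ?case by (auto simp: path_arcs_def)
next
  case (Cons x xs)
  show ?case
    using Cons.IH[of x "subdivide G (u, w) x"]
    by (auto simp: subdivide.simps path_arcs_Cons)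
qed

text \<open>An upper bound for the arcs, with the triangles enlarged to full squares including
  loops: in this form it is visibly symmetric in the three paths.\<close>

definition prism_bound :: "'a list \<Rightarrow> 'a list \<Rightarrow> 'a list \<Rightarrow> ('a \<times> 'a) set" where
  "prism_bound PA PB PC =
    (let E = {hd PA, hd PB, hd PC} \<times> {hd PA, hd PB, hd PC} \<union>
        {last PA, last PB, last PC} \<times> {last PA, last PB, last PC} \<union>
        path_arcs PA \<union> path_arcs PB \<union> path_arcs PC
     in E \<union> E\<inverse>)"

text \<open>The bijection reads off the list \<open>L\<close>, and each kind of arc in the bound is
  checked against \<open>prism_arc\<close>. A nonempty \<open>pC\<close> provides the vertex
  \<open>c\<close>.\<close>

lemma prism_labelling:
  fixes G :: "'a pair_pre_digraph"
  assumes dist: "distinct ([uA, uB, uC, wA, wB, wC] @ pA @ pB @ pC)" and pC: "pC \<noteq> []"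
    and verts: "pverts G = set ([uA, uB, uC, wA, wB, wC] @ pA @ pB @ pC)"
    and arcs: "parcs G \<subseteq> prism_bound (uA # pA @ [wA]) (uB # pB @ [wB]) (uC # pC @ [wC])"
  shows "\<exists>h s t N. 1 \<le> s \<and> s < t \<and> t + 2 \<le> N \<and> bij_betw h {..<N + 3} (pverts G) \<and>
    (\<forall>i<N + 3. \<forall>j<N + 3. i \<noteq> j \<longrightarrow> (h i, h j) \<in> parcs G \<longrightarrow> prism_adj N s t i j)"
proof -
  obtain c p where cp: "pC = c # p" using pC by (cases pC) auto
  define L where "L = [uC, uB] @ pB @ pA @ [wA, wC] @ rev p @ [uA, wB, c]"
  \<comment> \<open>If \<open>pB\<close> is empty, \<open>s = 1\<close> is the index of
    \<open>uB\<close>; if \<open>pA\<close> is empty, \<open>s + 1 = t\<close> is that of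
    \<open>wA\<close>. So \<open>s\<close> and \<open>s + 1\<close> are always the neighbours of
    \<open>wB\<close> and \<open>uA\<close> on their subdivided edges.\<close>
  define s where "s = length pB + 1"
  define t where "t = s + length pA + 1"
  define N where "N = t + 2 + length p"
  define h where "h = (\<lambda>i. L ! i)"
  have len: "length L = N + 3" by (simp add: L_def N_def t_def s_def)
  have dL: "distinct L" using dist by (auto simp: L_def cp)
  have hA: "h N = uA" "h (N + 1) = wB" "h (N + 2) = c" "h 0 = uC" "h 1 = uB" "h t = wA" "h (t + 1) = wC"
    by (simp_all add: h_def L_def N_def t_def s_def nth_append)
  have bij: "bij_betw h {..<N + 3} (pverts G)"
  proof -
    have "set L = pverts G" using verts by (auto simp: L_def cp)
    then show ?thesis unfolding h_def using bij_betw_nth[OF dL, of "{..<N + 3}"] len by simp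
  qed
  have inj: "i = j" if "h i = h j" "i < N + 3" "j < N + 3" for i j
    using that dL len by (simp add: h_def nth_eq_iff_index_eq)
  \<comment> \<open>Adjacency carried over to vertices, with equality allowed because
    \<open>prism_bound\<close> contains loops.\<close>
  define Q where "Q = (\<lambda>x y. \<exists>i j. i < N + 3 \<and> j < N + 3 \<and> x = h i \<and> y = h j \<and>
    (i = j \<or> prism_adj N s t i j))"
  have Qsym: "Q x y \<Longrightarrow> Q y x" for x y unfolding Q_def prism_adj_def by blast
  have QI: "Q (h i) (h j)" if "i < N + 3" "j < N + 3" "i = j \<or> prism_arc N s t i j" for i j
    using that unfolding Q_def prism_adj_def by blast
  have tri: "Q x y" if "x \<in> {uA, uB, uC}" "y \<in> {uA, uB, uC}" for x y
  proof -
    have "Q uA uA" "Q uB uB" "Q uC uC" "Q uA uB" "Q uA uC" "Q uC uB"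
      using QI[of N N] QI[of 1 1] QI[of 0 0] QI[of N 1] QI[of N 0] QI[of 0 1]
      unfolding hA by (auto simp: prism_arc_def N_def t_def s_def)
    then show ?thesis using that Qsym by blast
  qed
  have tri': "Q x y" if "x \<in> {wA, wB, wC}" "y \<in> {wA, wB, wC}" for x y
  proof -
    have "Q wA wA" "Q wB wB" "Q wC wC" "Q wB wA" "Q wB wC" "Q wA wC"
      using QI[of t t] QI[of "N + 1" "N + 1"] QI[of "t + 1" "t + 1"] QI[of "N + 1" t]
        QI[of "N + 1" "t + 1"] QI[of t "t + 1"]
      unfolding hA by (auto simp: prism_arc_def N_def t_def s_def)
    then show ?thesis using that Qsym by blast
  qed
  have pathA: "Q x y" if xy: "(x, y) \<in> path_arcs (uA # pA @ [wA])" for x y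
  proof -
    \<comment> \<open>Position \<open>i\<close> of the path has index \<open>s + i\<close>, except
      that position \<open>0\<close> is \<open>uA\<close> with index \<open>N\<close>.\<close>
    have nth: "(uA # pA @ [wA]) ! i = h (s + i)" if "1 \<le> i" "i \<le> length pA + 1" for i
      using that by (auto simp: h_def L_def s_def nth_append nth_Cons split: nat.splits)
    obtain i where "x = (uA # pA @ [wA]) ! i" "y = (uA # pA @ [wA]) ! Suc i"
        "Suc i < length (uA # pA @ [wA])"
      using xy unfolding path_arcs_def by blast
    then have i: "x = (uA # pA @ [wA]) ! i" "y = (uA # pA @ [wA]) ! Suc i" "i \<le> length pA"
      by simp_all
    have "Q (h (if i = 0 then N else s + i)) (h (s + Suc i))"
      using i(3) by (intro QI) (auto simp: prism_arc_def N_def t_def)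
    moreover have "x = h (if i = 0 then N else s + i)" using i nth[of i] hA(1) by simp
    moreover have "y = h (s + Suc i)" using i(2,3) nth[of "Suc i"] by simp
    ultimately show ?thesis by simp
  qed
  have pathB: "Q y x" if xy: "(x, y) \<in> path_arcs (uB # pB @ [wB])" for x y
  proof -
    \<comment> \<open>Positions are shifted by one, except that the last one, \<open>s\<close>, is
      \<open>wB\<close> with index \<open>N + 1\<close>.\<close>
    have nth: "(uB # pB @ [wB]) ! i = h (i + 1)" if "i < s" for i
      using that by (auto simp: h_def L_def s_def nth_append nth_Cons split: nat.splits)
    have nth': "(uB # pB @ [wB]) ! s = wB" by (simp add: s_def nth_append)
    obtain i where "x = (uB # pB @ [wB]) ! i" "y = (uB # pB @ [wB]) ! Suc i"
        "Suc i < length (uB # pB @ [wB])"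
      using xy unfolding path_arcs_def by blast
    then have i: "x = (uB # pB @ [wB]) ! i" "y = (uB # pB @ [wB]) ! Suc i" "i < s"
      by (simp_all add: s_def)
    show ?thesis
    proof (cases "Suc i = s")
      case True
      have "Q (h (N + 1)) (h s)"
        by (intro QI) (simp_all add: prism_arc_def N_def t_def)
      moreover have "x = h s" using i(1) nth[OF i(3)] True by (metis Suc_eq_plus1)
      moreover have "y = h (N + 1)" using i(2) nth' True hA(2) by metis
      ultimately show ?thesis by simp
    next
      case False
      have "Q (h (i + 1)) (h (i + 2))"
        using i(3) False by (intro QI) (simp_all add: prism_arc_def N_def t_def)
      moreover have "x = h (i + 1)" using i(1) nth[OF i(3)] by simp
      moreover have "y = h (i + 2)" using i(2,3) False nth[of "Suc i"] by simp
      ultimately show ?thesis using Qsym by simp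
    qed
  qed
  have pathC: "Q y x" if xy: "(x, y) \<in> path_arcs (uC # pC @ [wC])" for x y
  proof -
    \<comment> \<open>As \<open>p\<close> is stored in reverse, indices fall while positions rise.
      Positions \<open>0\<close> and \<open>1\<close> are \<open>uC\<close> and \<open>c\<close>,
      with indices \<open>0\<close> and \<open>N + 2\<close>.\<close>
    have nth: "(uC # pC @ [wC]) ! i = h (N + 1 - i)" if "2 \<le> i" "i \<le> length p + 2" for i
    proof -
      have "(uC # pC @ [wC]) ! i = (p @ [wC]) ! (i - 2)"
        using that by (auto simp: cp nth_Cons split: nat.splits)
      also have "\<dots> = rev (p @ [wC]) ! (length p + 2 - i)"
        using that by (subst rev_nth) auto
      also have "rev (p @ [wC]) ! (length p + 2 - i) = drop (t + 1) L ! (length p + 2 - i)"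
      proof -
        have "drop (t + 1) L = rev (p @ [wC]) @ [uA, wB, c]" by (simp add: L_def t_def s_def)
        moreover have "length p + 2 - i < length (rev (p @ [wC]))" using that by simp
        ultimately show ?thesis by (simp only: nth_append if_True)
      qed
      also have "\<dots> = h (N + 1 - i)"
      proof -
        have "t + 1 + (length p + 2 - i) = N + 1 - i" using that N_def by linarith
        moreover have "t + 1 \<le> length L" using len N_def by linarith
        ultimately show ?thesis by (simp only: nth_drop h_def)
      qed
      finally show ?thesis .
    qed
    obtain i where "x = (uC # pC @ [wC]) ! i" "y = (uC # pC @ [wC]) ! Suc i"
        "Suc i < length (uC # pC @ [wC])"
      using xy unfolding path_arcs_def by blast
    then have i: "x = (uC # pC @ [wC]) ! i" "y = (uC # pC @ [wC]) ! Suc i" "i \<le> length p + 1"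
      by (simp_all add: cp)
    consider "i = 0" | "i = 1" | "2 \<le> i" by linarith
    then show ?thesis
    proof cases
      case 1
      have "Q (h (N + 2)) (h 0)" by (intro QI) (simp_all add: prism_arc_def)
      then show ?thesis using i(1,2) 1 hA(3,4) by (simp add: cp)
    next
      case 2
      have "Q (h (N + 2)) (h (N - 1))" by (intro QI) (simp_all add: prism_arc_def)
      moreover have "x = h (N + 2)" using i(1) 2 hA(3) by (simp add: cp)
      moreover have "y = h (N - 1)" using i(2) 2 nth[of 2] by (simp add: numeral_2_eq_2)
      ultimately show ?thesis using Qsym by simp
    next
      case 3
      \<comment> \<open>This stretch has indices from \<open>t + 1\<close> on, beyond the break at
        \<open>s\<close>.\<close>
      have "N + 1 - i = Suc (N - i)" "N + 1 - i < N" "N - i \<noteq> s"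
        using i(3) 3 N_def t_def by linarith+
      then have "Q (h (N - i)) (h (N + 1 - i))" by (intro QI) (simp_all add: prism_arc_def)
      moreover have "x = h (N + 1 - i)" using i(1,3) 3 nth[of i] by simp
      moreover have "y = h (N - i)" using i(2,3) 3 nth[of "Suc i"] by simp
      ultimately show ?thesis by simp
    qed
  qed
  have "prism_bound (uA # pA @ [wA]) (uB # pB @ [wB]) (uC # pC @ [wC]) \<subseteq> {(x, y). Q x y}"
  proof -
    have sym: "E \<union> E\<inverse> \<subseteq> {(x, y). Q x y}" if "E \<subseteq> {(x, y). Q x y}" for E
      using that Qsym by blast
    have "path_arcs (uA # pA @ [wA]) \<subseteq> {(x, y). Q x y}" "path_arcs (uB # pB @ [wB]) \<subseteq> {(x, y). Q x y}"
      "path_arcs (uC # pC @ [wC]) \<subseteq> {(x, y). Q x y}"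
      using pathA pathB pathC Qsym by blast+
    moreover have "{uA, uB, uC} \<times> {uA, uB, uC} \<subseteq> {(x, y). Q x y}"
      "{wA, wB, wC} \<times> {wA, wB, wC} \<subseteq> {(x, y). Q x y}"
      using tri tri' by blast+
    ultimately show ?thesis
      unfolding prism_bound_def Let_def by (intro sym Un_least) simp_all
  qed
  then have Q: "Q x y" if "(x, y) \<in> parcs G" for x y using that arcs by blast
  \<comment> \<open>Injectivity of \<open>h\<close> recovers the indices hidden in \<open>Q\<close>,
    and \<open>i \<noteq> j\<close> discards the loops.\<close>
  have "prism_adj N s t i j" if ij: "i < N + 3" "j < N + 3" "i \<noteq> j" "(h i, h j) \<in> parcs G" for i j
    using Q[OF ij(4)] ij inj unfolding Q_def by blast
  moreover have "1 \<le> s" "s < t" "t + 2 \<le> N" by (simp_all add: s_def t_def N_def)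
  ultimately show ?thesis using bij by blast
qed

lemma prism_bound_permute:
  "prism_bound PA PC PB = prism_bound PA PB PC" "prism_bound PC PB PA = prism_bound PA PB PC"
  by (simp_all add: prism_bound_def Let_def insert_commute Un_ac)

text \<open>More than six vertices force some subdivided edge to have an inner vertex; by the
  symmetry of \<open>prism_bound\<close> it can take the role of \<open>uC wC\<close>.\<close>

lemma elongated_triangular_prism_labelling:
  fixes G :: "'a pair_pre_digraph"
  assumes G: "elongated_triangular_prism G" and card: "6 < card (pverts G)"
  shows "\<exists>h s t N. 1 \<le> s \<and> s < t \<and> t + 2 \<le> N \<and> bij_betw h {..<N + 3} (pverts G) \<and>
    (\<forall>i<N + 3. \<forall>j<N + 3. i \<noteq> j \<longrightarrow> (h i, h j) \<in> parcs G \<longrightarrow> prism_adj N s t i j)"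
proof -
  obtain uA uB uC wA wB wC pA pB pC where
    dist: "distinct ([uA, uB, uC, wA, wB, wC] @ pA @ pB @ pC)" and
    Gdef: "G = subdivide_edge pC (uC, wC) (subdivide_edge pB (uB, wB) (subdivide_edge pA (uA, wA)
            (triangular_prism uA uB uC wA wB wC)))"
    using G unfolding elongated_triangular_prism_def by blast
  let ?A = "uA # pA @ [wA]" and ?B = "uB # pB @ [wB]" and ?C = "uC # pC @ [wC]"
  have verts: "pverts G = set ([uA, uB, uC, wA, wB, wC] @ pA @ pB @ pC)"
    by (auto simp: Gdef pverts_subdivide_edge triangular_prism_def Let_def)
  let ?T = "triangular_prism uA uB uC wA wB wC"
  let ?edges = "{(uA, wA), (wA, uA)} \<union> {(uB, wB), (wB, uB)} \<union> {(uC, wC), (wC, uC)}"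
  let ?P = "path_arcs ?A \<union> (path_arcs ?A)\<inverse> \<union> (path_arcs ?B \<union> (path_arcs ?B)\<inverse>) \<union>
    (path_arcs ?C \<union> (path_arcs ?C)\<inverse>)"
  \<comment> \<open>Composes the three subdivisions, each of which removes one edge and adds a
    path.\<close>
  have trans: "Z \<subseteq> (W - (a \<union> b \<union> c)) \<union> (p \<union> q \<union> r)"
    if "X \<subseteq> (W - a) \<union> p" "Y \<subseteq> (X - b) \<union> q" "Z \<subseteq> (Y - c) \<union> r"
    for W X Y Z a b c p q r :: "('a \<times> 'a) set"
    using that by blast
  have "parcs G \<subseteq> (parcs ?T - ?edges) \<union> ?P"
    unfolding Gdef
    by (rule trans) (rule parcs_subdivide_edge)+
  also have "\<dots> \<subseteq> prism_bound ?A ?B ?C"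
  proof (rule Un_least)
    let ?F = "{(uA, uB), (uB, uC), (uC, uA), (wA, wB), (wB, wC), (wC, wA),
      (uA, wA), (uB, wB), (uC, wC)}"
      and ?D = "{uA, uB, uC} \<times> {uA, uB, uC} \<union> {wA, wB, wC} \<times> {wA, wB, wC}"
      and ?R = "{(uA, wA), (uB, wB), (uC, wC)}"
      and ?Q = "path_arcs ?A \<union> path_arcs ?B \<union> path_arcs ?C"
    have bound: "prism_bound ?A ?B ?C = (?D \<union> ?Q) \<union> (?D \<union> ?Q)\<inverse>"
      by (simp only: prism_bound_def Let_def list.sel last_ConsR last_snoc append_is_Nil_conv
          list.distinct simp_thms if_True if_False Un_assoc not_Cons_self2)
    have mono: "X \<union> X\<inverse> \<subseteq> Y \<union> Y\<inverse>" if "X \<subseteq> Y" for X Y :: "('a \<times> 'a) set"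
      using that by blast
    \<comment> \<open>With the subdivided edges \<open>R\<close> removed, only triangle arcs are
      left, and these lie in the squares \<open>D\<close>.\<close>
    have cover: "(F \<union> F\<inverse>) - Z \<subseteq> X" if "F \<subseteq> D \<union> R" "R \<union> R\<inverse> \<subseteq> Z" "D \<union> D\<inverse> \<subseteq> X"
      for F D R X Z :: "('a \<times> 'a) set"
      using that by blast
    have "parcs ?T = ?F \<union> ?F\<inverse>" by (simp only: triangular_prism_def Let_def pair_pre_digraph.select_convs)
    moreover have "?F \<union> ?F\<inverse> - ?edges \<subseteq> prism_bound ?A ?B ?C"
    proof (rule cover)
      show "?F \<subseteq> ?D \<union> ?R" by simp
      show "?R \<union> ?R\<inverse> \<subseteq> ?edges" by blast
      show "?D \<union> ?D\<inverse> \<subseteq> prism_bound ?A ?B ?C"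
        unfolding bound by (intro mono Un_upper1)
    qed
    ultimately show "parcs ?T - ?edges \<subseteq> prism_bound ?A ?B ?C" by (simp only:)
    have "?P = ?Q \<union> ?Q\<inverse>" by (simp only: converse_Un Un_ac)
    also have "\<dots> \<subseteq> prism_bound ?A ?B ?C"
      unfolding bound by (intro mono Un_upper2)
    finally show "?P \<subseteq> prism_bound ?A ?B ?C" .
  qed
  finally have arcs: "parcs G \<subseteq> prism_bound ?A ?B ?C" .
  have "card (pverts G) = 6 + length pA + length pB + length pC"
    unfolding verts using distinct_card[OF dist] by simp
  then consider "pA \<noteq> []" | "pB \<noteq> []" | "pC \<noteq> []" using card by fastforce
  then show ?thesis
  proof cases
    case 1
    show ?thesis
    proof (rule prism_labelling[OF _ 1])
      show "distinct ([uC, uB, uA, wC, wB, wA] @ pC @ pB @ pA)" using dist by auto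
      show "pverts G = set ([uC, uB, uA, wC, wB, wA] @ pC @ pB @ pA)" using verts by auto
      show "parcs G \<subseteq> prism_bound ?C ?B ?A" using arcs prism_bound_permute by metis
    qed
  next
    case 2
    show ?thesis
    proof (rule prism_labelling[OF _ 2])
      show "distinct ([uA, uC, uB, wA, wC, wB] @ pA @ pC @ pB)" using dist by auto
      show "pverts G = set ([uA, uC, uB, wA, wC, wB] @ pA @ pC @ pB)" using verts by auto
      show "parcs G \<subseteq> prism_bound ?A ?C ?B" using arcs prism_bound_permute by metis
    qed
  next
    case 3
    show ?thesis by (rule prism_labelling[OF dist 3 verts arcs])
  qed
qed

section \<open>Transfer of the branch sets from indices to the graph\<close>

theorem theorem8:
  fixes n :: nat and G :: "'a pair_pre_digraph"
  assumes "n \<ge> 7"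
    and "elongated_triangular_prism G"
    and "card (pverts G) = 2 * n - 3"
  shows "has_complete_minor n (complement_graph G)"
proof -
  obtain h s t N where st: "1 \<le> s" "s < t" "t + 2 \<le> N"
    and h: "bij_betw h {..<N + 3} (pverts G)"
    and adj: "\<And>i j. i < N + 3 \<Longrightarrow> j < N + 3 \<Longrightarrow> i \<noteq> j \<Longrightarrow> (h i, h j) \<in> parcs G \<Longrightarrow> prism_adj N s t i j"
  proof -
    have "6 < card (pverts G)" using assms(1,3) by simp
    then show ?thesis using elongated_triangular_prism_labelling[OF assms(2)] that by blast
  qed
  have "N + 3 = 2 * n - 3" using bij_betw_same_card[OF h] assms(3) by simp
  \<comment> \<open>Hence \<open>n - 3\<close> pairs and three singletons, \<open>n\<close> blocks
    in all.\<close>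
  then have N: "N = 2 * (n - 3)" using assms(1) by simp
  have "8 \<le> N" "even N" using N assms(1) by simp_all
  from prism_partition[OF st this] obtain P
    where P: "partition_on {..<N + 3} P" "card P = N div 2 + 3"
      and star: "\<forall>B\<in>P. \<exists>i\<in>B. \<forall>j\<in>B. j \<noteq> i \<longrightarrow> \<not> prism_adj N s t i j"
      and link: "\<forall>B\<in>P. \<forall>C\<in>P. B \<noteq> C \<longrightarrow> (\<exists>i\<in>B. \<exists>j\<in>C. \<not> prism_adj N s t i j)"
    by (elim exE conjE)
  have lt: "i < N + 3" if "i \<in> B" "B \<in> P" for i B
    using that partition_onD1[OF P(1)] by blast
  have "has_complete_minor (card P) (complement_graph G)"
  proof (rule complement_minor_of_partition[OF _ h P(1)])
    show "finite (pverts G)" using bij_betw_finite[OF h] by simp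
    show "\<exists>i\<in>B. \<forall>j\<in>B. j \<noteq> i \<longrightarrow> (h i, h j) \<notin> parcs G" if B: "B \<in> P" for B
    proof -
      obtain i where i: "i \<in> B" "\<forall>j\<in>B. j \<noteq> i \<longrightarrow> \<not> prism_adj N s t i j" using bspec[OF star B] by blast
      have "(h i, h j) \<notin> parcs G" if "j \<in> B" "j \<noteq> i" for j
        using adj[OF lt[OF i(1) B] lt[OF that(1) B]] i(2) that by blast
      then show ?thesis using i(1) by blast
    qed
    show "\<exists>i\<in>B. \<exists>j\<in>C. (h i, h j) \<notin> parcs G" if BC: "B \<in> P" "C \<in> P" "B \<noteq> C" for B C
    proof -
      obtain i j where ij: "i \<in> B" "j \<in> C" "\<not> prism_adj N s t i j" using link BC by blast
      \<comment> \<open>\<open>adj\<close> speaks of distinct indices only; disjointness of the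
        blocks provides this.\<close>
      have "i \<noteq> j" using ij(1,2) BC partition_onD2[OF P(1)] by (auto simp: disjoint_def)
      then have "(h i, h j) \<notin> parcs G" using adj[OF lt[OF ij(1) BC(1)] lt[OF ij(2) BC(2)]] ij(3) by blast
      then show ?thesis using ij(1,2) by blast
    qed
  qed
  then show ?thesis using P(2) N assms(1) by simp
qed

end
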